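(* Let $K$ be a field of characteristic zero (e.g. $K=\mathbb{C}$ or $\mathbb{C}_p$), $D=\frac{d}{dt}$, $\Delta=tD$. Let $P(x)\in K[x]$ with $\deg P=m\ge 2$, $P(-1)=0$, and $P(k)\neq 0$ for all integers $k\ge 0$, and let $$F(t)=\sum_{n=0}^{\infty}\frac{t^n}{\prod_{k=0}^{n-1}P(k)}.$$ Write $P(x)=(x+1)P_1(x+1)$ with $P_1\in K[x]$. Then $F$ satisfies $[\Delta P_1(\Delta)-t]F=0$, which can be written as $N\Delta^mF=P_1^*\Delta^{m-1}F+\dots+P_m^*\Delta^0F$ with $N\in K\setminus\{0\}$ (so $S=\deg N=0$), $P_j^*\in K$ (so $\deg P_j^*<1$) for $j=1,\dots,m-1$, and $\deg P_m^*=1$. Consequently, for this equation the following holds: for every $(A_{0,1},\dots,A_{0,m})\in K[t]^m\setminus\{(0,\dots,0)\}$, defining $A_{n,j}\in K[t]$ recursively by $$A_{k+1,j}=P_j^*A_{k,1}+N\,\Delta A_{k,j}+NA_{k,j+1}\ (j=1,\dots,m-1),\qquad A_{k+1,m}=P_m^*A_{k,1}+N\,\Delta A_{k,m},$$ the determinants $\det\big(A_{k+i-1,j}\big)_{1\le i,j\le m}$ are nonzero for all $k\in\mathbb{N}$.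
   Context: The $A_{n,j}$ are the coefficients of the linear forms $L_n=(N\Delta)^nL_0=A_{n,1}\Delta^{m-1}F+\dots+A_{n,m}\Delta^0F$ with $L_0=A_{0,1}\Delta^{m-1}F+\dots+A_{0,m}\Delta^0F$, obtained using the differential equation to eliminate $\Delta^mF$. $\mathbb{N}$ includes $0$. *)

theory Defs
  imports
    "HOL-Computational_Algebra.Polynomial_FPS"
    "Jordan_Normal_Form.Determinant"
begin

definition fps_Delta :: "'a::comm_ring_1 fps \<Rightarrow> 'a fps" where
  "fps_Delta G = fps_X * fps_deriv G"

definition poly_Delta :: "'a::idom poly \<Rightarrow> 'a poly" where
  "poly_Delta q = [:0, 1:] * pderiv q"

definition fps_poly_Delta :: "'a::comm_ring_1 poly \<Rightarrow> 'a fps \<Rightarrow> 'a fps" where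
  "fps_poly_Delta q G = (\<Sum>i\<le>degree q. fps_const (coeff q i) * (fps_Delta ^^ i) G)"

definition F_series :: "'a::field_char_0 poly \<Rightarrow> 'a fps" where
  "F_series P = Abs_fps (\<lambda>n. 1 / (\<Prod>k<n. poly P (of_nat k)))"

text \<open>The coefficients \<open>A\<^sub>k\<^sub>,\<^sub>j\<close> of \<open>L\<^sub>k = (N\<Delta>)\<^sup>k L\<^sub>0\<close> with respect to
  \<open>\<Delta>\<^sup>m\<^sup>-\<^sup>1F, \<dots>, \<Delta>\<^sup>0F\<close>. The column index \<open>j\<close> runs over \<open>{1..m}\<close>;
  values at other indices have no meaning.\<close>

primrec form_coeff ::
  "nat \<Rightarrow> 'a::idom poly \<Rightarrow> (nat \<Rightarrow> 'a poly) \<Rightarrow> (nat \<Rightarrow> 'a poly) \<Rightarrow> nat \<Rightarrow> nat \<Rightarrow> 'a poly" where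
  "form_coeff m N Ps A0 0 = A0"
| "form_coeff m N Ps A0 (Suc k) = (\<lambda>j.
     if j = m
     then Ps m * form_coeff m N Ps A0 k 1 + N * poly_Delta (form_coeff m N Ps A0 k m)
     else Ps j * form_coeff m N Ps A0 k 1 + N * poly_Delta (form_coeff m N Ps A0 k j)
          + N * form_coeff m N Ps A0 k (j + 1))"

text \<open>The matrix \<open>(A\<^bsub>k+i-1,j\<^esub>)\<close> with \<open>1 \<le> i,j \<le> m\<close>; the matrix library counts rows and columns from 0.\<close>

definition form_matrix ::
  "nat \<Rightarrow> 'a::idom poly \<Rightarrow> (nat \<Rightarrow> 'a poly) \<Rightarrow> (nat \<Rightarrow> 'a poly) \<Rightarrow> nat \<Rightarrow> 'a poly mat" where
  "form_matrix m N Ps A0 k = mat m m (\<lambda>(i, j). form_coeff m N Ps A0 (k + i) (j + 1))"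

text \<open>The shape of the equation
  \<open>N \<Delta>\<^sup>m G = P\<^sub>1\<^sup>* \<Delta>\<^sup>m\<^sup>-\<^sup>1 G + \<dots> + P\<^sub>m\<^sup>* \<Delta>\<^sup>0 G\<close>: \<open>N\<close> is a nonzero
  constant, \<open>P\<^sub>j\<^sup>*\<close> is a constant for \<open>j < m\<close>, and \<open>P\<^sub>m\<^sup>*\<close> has degree 1.
  Constants, including 0, are polynomials of degree 0.\<close>

definition eqn_shape :: "nat \<Rightarrow> 'a::zero poly \<Rightarrow> (nat \<Rightarrow> 'a poly) \<Rightarrow> bool" where
  "eqn_shape m N Ps \<longleftrightarrow>
     N \<noteq> 0 \<and> degree N = 0 \<and> (\<forall>j\<in>{1..m-1}. degree (Ps j) = 0) \<and> degree (Ps m) = 1"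

definition eqn_rhs :: "nat \<Rightarrow> (nat \<Rightarrow> 'a::comm_ring_1 poly) \<Rightarrow> 'a fps \<Rightarrow> 'a fps" where
  "eqn_rhs m Ps G = (\<Sum>j=1..m. fps_of_poly (Ps j) * (fps_Delta ^^ (m - j)) G)"

end

theory Submission imports Defs begin

text \<open>
  Give \<open>t\<^sup>q \<Delta>\<^sup>m\<^sup>-\<^sup>jF\<close> the weight \<open>m q + (m - j)\<close>, i.e. let \<open>\<Delta>\<close> have weight 1 and \<open>t\<close> weight \<open>m\<close>.
  As \<open>0 \<le> m - j < m\<close>, distinct monomials have distinct weights. Since \<open>N\<close> and \<open>P\<^sub>1\<^sup>*, \<dots>, P\<^sub>m\<^sub>-\<^sub>1\<^sup>*\<close> are
  constants and \<open>P\<^sub>m\<^sup>*\<close> is linear, \<open>N\<Delta>\<close> raises the top weight of a form by exactly 1, so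
  \<open>L\<^sub>k, \<dots>, L\<^bsub>k+m-1\<^esub>\<close> have consecutive top weights. Multiplication by a polynomial in \<open>t\<close> shifts weights
  by multiples of \<open>m\<close>; hence in a combination of these forms over \<open>K[t]\<close> the top weights are
  pairwise distinct modulo \<open>m\<close> and nothing can cancel.
\<close>

section \<open>Weights of vectors of polynomials\<close>

definition has_weight :: "nat \<Rightarrow> (nat \<Rightarrow> 'a::zero poly) \<Rightarrow> nat \<Rightarrow> bool" where
  "has_weight m v w \<longleftrightarrow>
     (\<exists>j\<in>{1..m}. \<exists>q. m * q + (m - j) = w \<and> coeff (v j) q \<noteq> 0) \<and>
     (\<forall>j\<in>{1..m}. \<forall>q. w < m * q + (m - j) \<longrightarrow> coeff (v j) q = 0)"

lemma has_weight_top: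
  assumes "has_weight m v w"
  obtains j q where "j \<in> {1..m}" "m * q + (m - j) = w" "coeff (v j) q \<noteq> 0"
  using assms unfolding has_weight_def by blast

lemma has_weight_above:
  assumes "has_weight m v w" "j \<in> {1..m}" "w < m * q + (m - j)"
  shows "coeff (v j) q = 0"
  using assms unfolding has_weight_def by blast

text \<open>In a nonzero component the leading term is the heaviest, so the largest of the finitely
  many numbers \<open>m * degree (v j) + (m - j)\<close> is the weight.\<close>

lemma has_weight_exists:
  assumes "\<exists>j\<in>{1..m}. v j \<noteq> 0"
  shows "\<exists>w. has_weight m v w"
proof -
  let ?J = "{j\<in>{1..m}. v j \<noteq> 0}"
  let ?f = "\<lambda>j. m * degree (v j) + (m - j)"
  have fin: "finite (?f ` ?J)" and ne: "?f ` ?J \<noteq> {}" using assms by auto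
  obtain j where j: "j \<in> ?J" "Max (?f ` ?J) = ?f j" using Max_in[OF fin ne] by blast
  have "coeff (v i) q = 0" if i: "i \<in> {1..m}" and q: "Max (?f ` ?J) < m * q + (m - i)" for i q
  proof (rule ccontr)
    assume nz: "coeff (v i) q \<noteq> 0"
    then have "i \<in> ?J" using i by auto
    then have "?f i \<le> Max (?f ` ?J)" using fin by auto
    moreover have "m * q \<le> m * degree (v i)" using le_degree[OF nz] by simp
    ultimately show False using q by linarith
  qed
  then have "has_weight m v (Max (?f ` ?J))"
    unfolding has_weight_def using j by (metis (mono_tags, lifting) leading_coeff_0_iff mem_Collect_eq)
  then show ?thesis by blast
qed

text \<open>The top monomial is the leading term of its component, so its product with the leading
  term of \<open>c\<close> survives in an integral domain.\<close>

lemma has_weight_mult: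
  fixes v :: "nat \<Rightarrow> 'a::idom poly"
  assumes w: "has_weight m v w" and "c \<noteq> 0"
  shows "has_weight m (\<lambda>j. c * v j) (m * degree c + w)"
proof -
  obtain j q where j: "j \<in> {1..m}" "m * q + (m - j) = w" "coeff (v j) q \<noteq> 0"
    using has_weight_top[OF w] .
  have "degree (v j) \<le> q"
  proof (rule degree_le, intro allI impI)
    fix p assume "q < p"
    then have "m * q < m * p" using j(1) by simp
    then show "coeff (v j) p = 0" using has_weight_above[OF w j(1), of p] j(2) by linarith
  qed
  with j(3) have "degree (v j) = q" by (metis le_antisym le_degree)
  then have "coeff (c * v j) (degree c + q) \<noteq> 0"
    using j(3) \<open>c \<noteq> 0\<close> by (metis coeff_mult_degree_sum leading_coeff_0_iff mult_eq_0_iff)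
  moreover have "m * (degree c + q) + (m - j) = m * degree c + w"
    using j(2) by (simp add: algebra_simps)
  moreover have "coeff (c * v i) p = 0"
    if i: "i \<in> {1..m}" and p: "m * degree c + w < m * p + (m - i)" for i p
  proof (cases "v i = 0")
    case False
    have "m * degree (v i) + (m - i) \<le> w"
      using has_weight_above[OF w i, of "degree (v i)"] False by force
    then have "m * (degree c + degree (v i)) < m * p" using p by (simp add: algebra_simps)
    then have "degree c + degree (v i) < p" by simp
    then show ?thesis by (meson coeff_eq_0 degree_mult_le le_less_trans)
  qed simp
  ultimately show ?thesis unfolding has_weight_def using j(1) by blast
qed

text \<open>The top monomial of the heaviest summand occurs in no other summand: by injectivity the
  others are strictly lighter.\<close>

lemma has_weight_sum_nonzero:
  fixes v :: "'i \<Rightarrow> nat \<Rightarrow> 'a::comm_monoid_add poly"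
  assumes fin: "finite I" and "I \<noteq> {}"
    and w: "\<And>i. i \<in> I \<Longrightarrow> has_weight m (v i) (w i)"
    and inj: "inj_on w I"
  shows "\<exists>j\<in>{1..m}. (\<Sum>i\<in>I. v i j) \<noteq> 0"
proof -
  have "Max (w ` I) \<in> w ` I" using fin \<open>I \<noteq> {}\<close> by simp
  then obtain k where k: "k \<in> I" "Max (w ` I) = w k" by auto
  obtain j q where j: "j \<in> {1..m}" "m * q + (m - j) = w k" "coeff (v k j) q \<noteq> 0"
    using has_weight_top[OF w[OF k(1)]] .
  have "coeff (v i j) q = 0" if i: "i \<in> I - {k}" for i
  proof -
    have "w i \<le> w k" using Max_ge[of "w ` I" "w i"] fin i k by auto
    moreover have "w i \<noteq> w k" using inj i k(1) by (auto dest: inj_onD)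
    ultimately show ?thesis using has_weight_above[OF w j(1)] i j(2) by simp
  qed
  then have "coeff (\<Sum>i\<in>I. v i j) q = coeff (v k j) q"
    using fin k(1) by (simp add: coeff_sum sum.remove)
  then show ?thesis using j by (metis coeff_0)
qed

section \<open>The recursion raises the weight by one\<close>

lemma coeff_poly_Delta: "coeff (poly_Delta q) n = of_nat n * coeff q n"
  by (cases n) (simp_all add: poly_Delta_def coeff_pderiv)

lemma degree_0_const_coeff:
  assumes "degree p = 0"
  obtains c where "p = [:c:]" "c \<noteq> 0 \<longleftrightarrow> p \<noteq> 0"
  using assms by (metis degree_eq_zeroE pCons_eq_0_iff)

text \<open>A top monomial in column \<open>j > 1\<close> moves to column \<open>j - 1\<close> with
  factor \<open>N\<close>. From column 1 it would reach \<Delta>^m F, which the equation eliminates;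
  the linear term of \<open>Ps m\<close> then carries it to column \<open>m\<close> with exponent
  \<open>q + 1\<close>. Every other contribution weighs at most \<open>w\<close>.\<close>

lemma form_coeff_Suc_has_weight:
  fixes Ps A0 :: "nat \<Rightarrow> 'a::idom poly"
  assumes shape: "eqn_shape m N Ps" and w: "has_weight m (form_coeff m N Ps A0 k) w"
  shows "has_weight m (form_coeff m N Ps A0 (Suc k)) (Suc w)"
proof -
  let ?v = "form_coeff m N Ps A0 k" and ?u = "form_coeff m N Ps A0 (Suc k)"
  obtain c where c: "N = [:c:]" "c \<noteq> 0"
    using shape unfolding eqn_shape_def by (metis degree_0_const_coeff)
  obtain a b where ab: "Ps m = [:a, b:]" "b \<noteq> 0"
    using shape unfolding eqn_shape_def
    by (metis One_nat_def degree_eq_zeroE degree_pCons_eq_if nat.inject one_neq_zero pCons_0_0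
        pCons_cases)
  have u: "coeff (?u j) q = coeff (Ps j) 0 * coeff (?v 1) q + c * (of_nat q * coeff (?v j) q)
      + c * coeff (?v (j + 1)) q" if j: "j \<in> {1..m}" "j \<noteq> m" for j q
  proof -
    have "degree (Ps j) = 0" using shape j unfolding eqn_shape_def by auto
    then obtain d where "Ps j = [:d:]" by (rule degree_0_const_coeff)
    then show ?thesis using j c by (simp add: coeff_poly_Delta)
  qed
  \<comment> \<open>The linear term of \<open>Ps m\<close> appears as \<open>pCons 0\<close>, a
    shift of exponents by one.\<close>
  have um: "coeff (?u m) q = a * coeff (?v 1) q + coeff (pCons 0 (Polynomial.smult b (?v 1))) q
      + c * (of_nat q * coeff (?v m) q)" for q
    using c ab by (simp add: coeff_poly_Delta)
  have above: "coeff (?v j) q = 0" if "j \<in> {1..m}" "w < m * q + (m - j)" for j q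
    using has_weight_above[OF w that] .
  obtain j q where j: "j \<in> {1..m}" "m * q + (m - j) = w" "coeff (?v j) q \<noteq> 0"
    using has_weight_top[OF w] .
  have "\<exists>i\<in>{1..m}. \<exists>p. m * p + (m - i) = Suc w \<and> coeff (?u i) p \<noteq> 0"
  proof (cases "j = 1")
    case True
    have "m * (q + 1) + (m - m) = Suc w" using j True by (simp add: algebra_simps)
    moreover have "coeff (?v 1) (Suc q) = 0" "coeff (?v m) (Suc q) = 0"
      using j True by (auto intro!: above simp: algebra_simps)
    then have "coeff (?u m) (q + 1) \<noteq> 0" unfolding um using j(3) True ab(2) by simp
    ultimately show ?thesis using j(1) by (intro bexI[of _ m] exI[of _ "q + 1"]) auto
  next
    case False
    then have i: "j - 1 \<in> {1..m}" "j - 1 \<noteq> m" using j(1) by auto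
    have "m * q + (m - (j - 1)) = Suc w" using j False by auto
    moreover have "coeff (?v 1) q = 0" "coeff (?v (j - 1)) q = 0"
      using j False by (auto intro!: above)
    then have "coeff (?u (j - 1)) q \<noteq> 0" unfolding u[OF i] using j False c(2) by simp
    ultimately show ?thesis using i by blast
  qed
  moreover have "coeff (?u i) p = 0"
    if i: "i \<in> {1..m}" and p: "Suc w < m * p + (m - i)" for i p
  proof (cases "i = m")
    case True
    have "coeff (?v 1) p = 0" "coeff (?v m) p = 0" using True p i by (auto intro!: above)
    \<comment> \<open>At \<open>p = 0\<close> the shifted summand contributes nothing; otherwise it
      comes from a monomial of weight \<open>m * p - 1\<close>, still above
      \<open>w\<close>.\<close>
    moreover have "coeff (?v 1) (p - 1) = 0" if "p \<noteq> 0"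
      using that True p i by (cases p) (auto intro!: above)
    ultimately show ?thesis unfolding True um by (auto simp: coeff_pCons split: nat.split)
  next
    case False
    have "coeff (?v 1) p = 0" "coeff (?v i) p = 0" "coeff (?v (i + 1)) p = 0"
      using False p i by (auto intro!: above)
    then show ?thesis unfolding u[OF i False] by simp
  qed
  ultimately show ?thesis unfolding has_weight_def by blast
qed

lemma form_coeff_has_weight:
  fixes Ps A0 :: "nat \<Rightarrow> 'a::idom poly"
  assumes "eqn_shape m N Ps" and "has_weight m A0 w"
  shows "has_weight m (form_coeff m N Ps A0 k) (w + k)"
proof (induction k)
  case (Suc k)
  then show ?case using form_coeff_Suc_has_weight[OF assms(1)] by simp
qed (use assms(2) in simp)

section \<open>Nonvanishing of the determinants\<close>

lemma det_form_matrix_nonzero: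
  fixes Ps A0 :: "nat \<Rightarrow> 'a::idom poly"
  assumes shape: "eqn_shape m N Ps" and nz: "\<exists>j\<in>{1..m}. A0 j \<noteq> 0"
  shows "det (form_matrix m N Ps A0 k) \<noteq> 0"
proof
  let ?M = "form_matrix m N Ps A0 k"
  have M: "?M \<in> carrier_mat m m" by (simp add: form_matrix_def)
  assume "det ?M = 0"
  \<comment> \<open>A kernel vector of the transpose is a relation between the rows, each of which
    is one form.\<close>
  then have "det (transpose_mat ?M) = 0" using det_transpose[OF M] by simp
  then obtain c where c: "c \<in> carrier_vec m" "c \<noteq> 0\<^sub>v m" "transpose_mat ?M *\<^sub>v c = 0\<^sub>v m"
    using det_0_iff_vec_prod_zero[of "transpose_mat ?M" m] M by auto
  obtain w where w: "has_weight m A0 w" using has_weight_exists[OF nz] ..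
  \<comment> \<open>Zero multiples of rows have no weight and are discarded.\<close>
  define I where "I = {i. i < m \<and> c $ i \<noteq> 0}"
  define v where "v i j = c $ i * form_coeff m N Ps A0 (k + i) j" for i j
  have "I \<noteq> {}" using c(1,2) by (auto simp: I_def intro!: eq_vecI)
  moreover have "has_weight m (v i) (m * degree (c $ i) + (w + (k + i)))" if "i \<in> I" for i
    unfolding v_def using has_weight_mult[OF form_coeff_has_weight[OF shape w]] that
    by (simp add: I_def)
  moreover have "inj_on (\<lambda>i. m * degree (c $ i) + (w + (k + i))) I"
  proof (rule inj_onI)
    fix i i' assume i: "i \<in> I" "i' \<in> I"
      and "m * degree (c $ i) + (w + (k + i)) = m * degree (c $ i') + (w + (k + i'))"
    \<comment> \<open>Cancelling the common shift \<open>w + k\<close> and reducing modulo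
      \<open>m\<close> leaves the row indices, both below \<open>m\<close>.\<close>
    then have "(m * degree (c $ i) + i) mod m = (m * degree (c $ i') + i') mod m" by simp
    then show "i = i'" using i by (simp add: I_def)
  qed
  moreover have "finite I" by (simp add: I_def)
  ultimately obtain j where j: "j \<in> {1..m}" "(\<Sum>i\<in>I. v i j) \<noteq> 0"
    using has_weight_sum_nonzero[of I m v "\<lambda>i. m * degree (c $ i) + (w + (k + i))"] by blast
  have "(\<Sum>i\<in>I. v i j) = (\<Sum>i<m. v i j)"
    by (rule sum.mono_neutral_left) (auto simp: I_def v_def)
  also have "\<dots> = (transpose_mat ?M *\<^sub>v c) $ (j - 1)"
    using j(1) c(1) by (auto simp: form_matrix_def v_def scalar_prod_def mult.commute
        lessThan_atLeast0 intro!: sum.cong)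
  also have "\<dots> = 0" using c(3) j(1) by auto
  finally show False using j(2) by simp
qed

section \<open>The differential equation of F\<close>

text \<open>Each \<open>t^n\<close> is an eigenvector of \<Delta> with eigenvalue \<open>n\<close>,
  so polynomials in \<Delta> act coefficientwise.\<close>

lemma fps_nth_Delta_power: "fps_nth ((fps_Delta ^^ i) G) n = of_nat n ^ i * fps_nth G n"
proof (induction i)
  case (Suc i)
  then show ?case by (cases n) (simp_all add: fps_Delta_def mult.assoc)
qed simp

lemma fps_nth_Delta: "fps_nth (fps_Delta G) n = of_nat n * fps_nth G n"
  using fps_nth_Delta_power[of 1] by simp

lemma fps_nth_poly_Delta: "fps_nth (fps_poly_Delta q G) n = poly q (of_nat n) * fps_nth G n"
  by (simp add: fps_poly_Delta_def fps_sum_nth fps_nth_Delta_power poly_altdef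
      sum_distrib_right mult.assoc)

text \<open>For \<open>n = k + 1\<close> the factor \<open>n * P1(n) = P(k)\<close> is the last one
  in the denominator of the coefficient of \<open>t^n\<close> in F; cancelling it leaves the
  coefficient of \<open>t^k\<close>. At \<open>n = 0\<close> both sides vanish.\<close>

lemma F_series_equation:
  fixes P P1 :: "'a::field_char_0 poly"
  assumes P: "P = [:1, 1:] * pcompose P1 [:1, 1:]"
    and nz: "\<And>k::nat. poly P (of_nat k) \<noteq> 0"
  shows "fps_Delta (fps_poly_Delta P1 (F_series P)) = fps_X * F_series P"
proof (rule fps_ext)
  fix n
  show "fps_nth (fps_Delta (fps_poly_Delta P1 (F_series P))) n = fps_nth (fps_X * F_series P) n"
  proof (cases n)
    case (Suc k)
    have "poly P (of_nat k) = of_nat n * poly P1 (of_nat n)"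
      by (subst P) (simp add: poly_pcompose Suc algebra_simps)
    then have "fps_nth (fps_Delta (fps_poly_Delta P1 (F_series P))) n
        = poly P (of_nat k) * fps_nth (F_series P) n"
      by (simp only: fps_nth_Delta fps_nth_poly_Delta mult.assoc)
    also have "\<dots> = fps_nth (fps_X * F_series P) n"
      using nz[of k] by (simp add: F_series_def Suc)
    finally show ?thesis .
  qed (simp add: fps_nth_Delta)
qed

text \<open>Expand \<Delta> P1(\<Delta>) - t in powers of \<Delta>: the leading coefficient of
  \<open>P1\<close> becomes \<open>N\<close>, the middle terms change sign and become the constants
  \<open>Ps j\<close>, and the only term free of \<Delta> gives \<open>Ps m = t\<close>.\<close>

lemma eqn_shape_exists:
  fixes P1 :: "'a::idom poly"
  assumes deg: "degree P1 = m - 1" and "P1 \<noteq> 0" and m: "m \<ge> 1"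
  shows "\<exists>N Ps. eqn_shape m N Ps \<and>
    (\<forall>G. fps_Delta (fps_poly_Delta P1 G) - fps_X * G
         = fps_of_poly N * (fps_Delta ^^ m) G - eqn_rhs m Ps G)"
proof (intro exI conjI allI)
  let ?N = "[:lead_coeff P1:]"
  let ?Ps = "\<lambda>j. if j = m then [:0, 1:] else [:- coeff P1 (m - 1 - j):]"
  show "eqn_shape m ?N ?Ps" using \<open>P1 \<noteq> 0\<close> by (auto simp: eqn_shape_def)
  fix G :: "'a fps"
  obtain d where d: "m = Suc d" using m by (cases m) auto
  have "eqn_rhs m ?Ps G = (\<Sum>j=1..d. fps_of_poly (?Ps j) * (fps_Delta ^^ (m - j)) G) + fps_X * G"
    by (simp add: eqn_rhs_def d fps_of_poly_pCons)
  also have "(\<Sum>j=1..d. fps_of_poly (?Ps j) * (fps_Delta ^^ (m - j)) G)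
      = (\<Sum>i<d. - (fps_const (coeff P1 i) * (fps_Delta ^^ Suc i) G))"
    \<comment> \<open>As \<open>m = d + 1\<close>, the power \<open>m - j\<close> of \<Delta> is
      \<open>i + 1\<close> for \<open>i = d - j\<close>.\<close>
    by (rule sum.reindex_bij_witness[of _ "\<lambda>i. d - i" "\<lambda>j. d - j"])
      (auto simp: d fps_of_poly_pCons Suc_diff_le simp flip: fps_const_neg)
  finally have rhs: "eqn_rhs m ?Ps G =
      fps_X * G - (\<Sum>i<d. fps_const (coeff P1 i) * (fps_Delta ^^ Suc i) G)"
    by (simp add: sum_negf)
  have "fps_Delta (fps_poly_Delta P1 G) = (\<Sum>i\<le>d. fps_const (coeff P1 i) * (fps_Delta ^^ Suc i) G)"
    by (rule fps_ext) (simp add: fps_nth_Delta fps_nth_Delta_power fps_nth_poly_Delta fps_sum_nth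
        poly_altdef deg d sum_distrib_left sum_distrib_right mult_ac del: funpow.simps)
  also have "\<dots> = (\<Sum>i<d. fps_const (coeff P1 i) * (fps_Delta ^^ Suc i) G)
      + fps_of_poly ?N * (fps_Delta ^^ m) G"
    by (simp add: deg d fps_of_poly_pCons flip: lessThan_Suc_atMost)
  finally show "fps_Delta (fps_poly_Delta P1 G) - fps_X * G
      = fps_of_poly ?N * (fps_Delta ^^ m) G - eqn_rhs m ?Ps G"
    unfolding rhs by simp
qed

text \<open>Existence of \<open>P1\<close> and of \<open>N\<close>, \<open>Ps\<close> is asserted
  separately, so that the universally quantified clauses are not vacuous.\<close>

theorem theorem4p4:
  fixes P :: "'a::field_char_0 poly" and m :: nat and F :: "'a fps"
  assumes "degree P = m" and "m \<ge> 2"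
    and "poly P (-1) = 0"
    and "\<And>k::nat. poly P (of_nat k) \<noteq> 0"
    and "F = F_series P"
  shows "(\<exists>P1. P = [:1, 1:] * pcompose P1 [:1, 1:]) \<and>
    (\<forall>P1. P = [:1, 1:] * pcompose P1 [:1, 1:] \<longrightarrow>
      fps_Delta (fps_poly_Delta P1 F) - fps_X * F = 0 \<and>
      (\<exists>N Ps. eqn_shape m N Ps \<and>
         (\<forall>G. fps_Delta (fps_poly_Delta P1 G) - fps_X * G
              = fps_of_poly N * (fps_Delta ^^ m) G - eqn_rhs m Ps G) \<and>
         fps_of_poly N * (fps_Delta ^^ m) F = eqn_rhs m Ps F) \<and>
      (\<forall>N Ps. eqn_shape m N Ps \<longrightarrow>
         fps_of_poly N * (fps_Delta ^^ m) F = eqn_rhs m Ps F \<longrightarrow>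
         (\<forall>A0 :: nat \<Rightarrow> 'a poly. (\<exists>j\<in>{1..m}. A0 j \<noteq> 0) \<longrightarrow>
            (\<forall>k. det (form_matrix m N Ps A0 k) \<noteq> 0))))"
proof (intro conjI allI impI)
  have "[:1, 1:] dvd P" using assms(3) by (simp add: poly_eq_0_iff_dvd)
  then obtain Q where "P = [:1, 1:] * Q" ..
  \<comment> \<open>The witness for \<open>P1\<close> is Q(x - 1), as substituting x + 1 undoes the
    shift.\<close>
  moreover have "pcompose (pcompose Q [:-1, 1:]) [:1, 1:] = Q"
    by (simp add: pcompose_pCons flip: pcompose_assoc)
  ultimately show "\<exists>P1. P = [:1, 1:] * pcompose P1 [:1, 1:]" by metis
next
  fix P1 assume P1: "P = [:1, 1:] * pcompose P1 [:1, 1:]"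
  show eq: "fps_Delta (fps_poly_Delta P1 F) - fps_X * F = 0"
    using F_series_equation[OF P1 assms(4)] assms(5) by simp
  have nz: "P1 \<noteq> 0" using P1 assms(1,2) by auto
  have "pcompose P1 [:1, 1:] \<noteq> 0" using P1 assms(1,2) by auto
  then have "degree P = 1 + degree (pcompose P1 [:1, 1:])"
    by (subst P1, subst degree_mult_eq) auto
  then have deg: "degree P1 = m - 1" using assms(1) by (simp add: degree_pcompose)
  have "m \<ge> 1" using assms(2) by simp
  from eqn_shape_exists[OF deg nz this] obtain N Ps where
    "eqn_shape m N Ps" and "\<forall>G. fps_Delta (fps_poly_Delta P1 G) - fps_X * G
      = fps_of_poly N * (fps_Delta ^^ m) G - eqn_rhs m Ps G" by blast
  then show "\<exists>N Ps. eqn_shape m N Ps \<and>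
      (\<forall>G. fps_Delta (fps_poly_Delta P1 G) - fps_X * G
           = fps_of_poly N * (fps_Delta ^^ m) G - eqn_rhs m Ps G) \<and>
      fps_of_poly N * (fps_Delta ^^ m) F = eqn_rhs m Ps F"
    using eq by (metis eq_iff_diff_eq_0)
next
  fix N :: "'a poly" and Ps A0 :: "nat \<Rightarrow> 'a poly" and k
  assume "eqn_shape m N Ps" "\<exists>j\<in>{1..m}. A0 j \<noteq> 0"
  then show "det (form_matrix m N Ps A0 k) \<noteq> 0" by (rule det_form_matrix_nonzero)
qed

end
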